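(* Let $A$ be a ring and let $X$ be a projective $\Sigma$-d-Rickart $A$-module. Then the endomorphism ring $S=\operatorname{End}_A(X)$ is von Neumann regular.
   Context: Rings are associative with unity and modules are unital right $A$-modules. A module $M$ is d-Rickart if $\operatorname{Im}(\phi)$ is a direct summand of $M$ for every $\phi\in\operatorname{End}_A(M)$. A module $X$ is $\Sigma$-d-Rickart if the direct sum $X^{(\Lambda)}$ of $\Lambda$ copies of $X$ is d-Rickart for every non-empty index set $\Lambda$. *)

theory Defs
  imports "HOL-Algebra.AbelCoset" "HOL-Algebra.Module"
begin

section \<open>Right modules over a ring that need not be commutative\<close>

text \<open>
  The modules of HOL-Algebra are left modules over a commutative ring. As there, a module record
  extends the ring record because that is where \<open>abelian_group\<close> lives; the fields \<open>mult\<close> and \<open>one\<close>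
  of a module carry no meaning and nothing below depends on them.
\<close>

record ('a, 'x) rmodule = "'x ring" +
  ract :: "'x \<Rightarrow> 'a \<Rightarrow> 'x" (infixl \<open>\<cdot>\<index>\<close> 70)

locale right_module = A?: ring A + M?: abelian_group M
  for A :: "('a, 'r) ring_scheme" (structure) and M :: "('a, 'x, 'm) rmodule_scheme" (structure) +
  assumes ract_closed [simp, intro]:
      "\<lbrakk>x \<in> carrier M; a \<in> carrier A\<rbrakk> \<Longrightarrow> x \<cdot>\<^bsub>M\<^esub> a \<in> carrier M"
    and ract_add_ring:
      "\<lbrakk>x \<in> carrier M; a \<in> carrier A; b \<in> carrier A\<rbrakk>
        \<Longrightarrow> x \<cdot>\<^bsub>M\<^esub> (a \<oplus>\<^bsub>A\<^esub> b) = x \<cdot>\<^bsub>M\<^esub> a \<oplus>\<^bsub>M\<^esub> x \<cdot>\<^bsub>M\<^esub> b"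
    and ract_add:
      "\<lbrakk>x \<in> carrier M; y \<in> carrier M; a \<in> carrier A\<rbrakk>
        \<Longrightarrow> (x \<oplus>\<^bsub>M\<^esub> y) \<cdot>\<^bsub>M\<^esub> a = x \<cdot>\<^bsub>M\<^esub> a \<oplus>\<^bsub>M\<^esub> y \<cdot>\<^bsub>M\<^esub> a"
    and ract_assoc:
      "\<lbrakk>x \<in> carrier M; a \<in> carrier A; b \<in> carrier A\<rbrakk>
        \<Longrightarrow> x \<cdot>\<^bsub>M\<^esub> (a \<otimes>\<^bsub>A\<^esub> b) = (x \<cdot>\<^bsub>M\<^esub> a) \<cdot>\<^bsub>M\<^esub> b"
    and ract_one [simp]:
      "x \<in> carrier M \<Longrightarrow> x \<cdot>\<^bsub>M\<^esub> \<one>\<^bsub>A\<^esub> = x"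

definition rsubmodule ::
  "('a, 'r) ring_scheme \<Rightarrow> ('a, 'x, 'm) rmodule_scheme \<Rightarrow> 'x set \<Rightarrow> bool"
  where "rsubmodule A M N \<longleftrightarrow>
    subgroup N (add_monoid M) \<and> (\<forall>x\<in>N. \<forall>a\<in>carrier A. x \<cdot>\<^bsub>M\<^esub> a \<in> N)"

definition direct_summand ::
  "('a, 'r) ring_scheme \<Rightarrow> ('a, 'x, 'm) rmodule_scheme \<Rightarrow> 'x set \<Rightarrow> bool"
  where "direct_summand A M N \<longleftrightarrow> rsubmodule A M N \<and>
    (\<exists>K. rsubmodule A M K \<and> N \<inter> K = {\<zero>\<^bsub>M\<^esub>} \<and> N <+>\<^bsub>M\<^esub> K = carrier M)"

text \<open>
  Homomorphisms are extensional (\<open>undefined\<close> outside the carrier), so that equality of functions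
  is equality of homomorphisms.
\<close>

definition rmod_hom ::
  "('a, 'r) ring_scheme \<Rightarrow> ('a, 'x, 'm) rmodule_scheme \<Rightarrow> ('a, 'y, 'n) rmodule_scheme
    \<Rightarrow> ('x \<Rightarrow> 'y) set"
  where "rmod_hom A M N = {f \<in> carrier M \<rightarrow>\<^sub>E carrier N.
    (\<forall>x\<in>carrier M. \<forall>y\<in>carrier M. f (x \<oplus>\<^bsub>M\<^esub> y) = f x \<oplus>\<^bsub>N\<^esub> f y) \<and>
    (\<forall>x\<in>carrier M. \<forall>a\<in>carrier A. f (x \<cdot>\<^bsub>M\<^esub> a) = f x \<cdot>\<^bsub>N\<^esub> a)}"

definition End_ring ::
  "('a, 'r) ring_scheme \<Rightarrow> ('a, 'x, 'm) rmodule_scheme \<Rightarrow> ('x \<Rightarrow> 'x) ring"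
  where "End_ring A X =
    \<lparr>carrier = rmod_hom A X X,
     mult = (\<lambda>f g. compose (carrier X) f g),
     one = (\<lambda>x\<in>carrier X. x),
     zero = (\<lambda>x\<in>carrier X. \<zero>\<^bsub>X\<^esub>),
     add = (\<lambda>f g. \<lambda>x\<in>carrier X. f x \<oplus>\<^bsub>X\<^esub> g x)\<rparr>"

definition von_neumann_regular :: "('s, 'm) ring_scheme \<Rightarrow> bool"
  where "von_neumann_regular S \<longleftrightarrow>
    ring S \<and> (\<forall>s\<in>carrier S. \<exists>t\<in>carrier S. s \<otimes>\<^bsub>S\<^esub> t \<otimes>\<^bsub>S\<^esub> s = s)"


section \<open>Direct sums of copies and the d-Rickart conditions\<close>

definition copower :: "('a, 'x, 'm) rmodule_scheme \<Rightarrow> 'i set \<Rightarrow> ('a, 'i \<Rightarrow> 'x) rmodule"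
  where "copower X \<Lambda> =
    \<lparr>carrier = {u \<in> \<Lambda> \<rightarrow>\<^sub>E carrier X. finite {i \<in> \<Lambda>. u i \<noteq> \<zero>\<^bsub>X\<^esub>}},
     mult = undefined,
     one = undefined,
     zero = (\<lambda>i\<in>\<Lambda>. \<zero>\<^bsub>X\<^esub>),
     add = (\<lambda>u v. \<lambda>i\<in>\<Lambda>. u i \<oplus>\<^bsub>X\<^esub> v i),
     ract = (\<lambda>u a. \<lambda>i\<in>\<Lambda>. u i \<cdot>\<^bsub>X\<^esub> a)\<rparr>"

definition d_rickart :: "('a, 'r) ring_scheme \<Rightarrow> ('a, 'x, 'm) rmodule_scheme \<Rightarrow> bool"
  where "d_rickart A M \<longleftrightarrow> (\<forall>\<phi>\<in>rmod_hom A M M. direct_summand A M (\<phi> ` carrier M))"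

text \<open>
  A definition cannot quantify over all types of index sets. The type \<open>'x + nat\<close> suffices: it has
  subsets of every cardinality up to some infinite \<open>\<kappa>\<close> not below that of the set \<open>X\<close>, and if all
  \<open>X\<^sup>\<Lambda>\<close> (direct sums) with \<open>card \<Lambda> \<le> \<kappa>\<close> are d-Rickart, then all are. For let \<open>\<phi>\<close> be an endomorphism
  of \<open>X\<^sup>\<Lambda>\<close>, \<open>\<Lambda>\<close> arbitrary, and write \<open>X_\<Gamma>\<close> for the elements supported in \<open>\<Gamma>\<close>. Closing off, \<open>\<Lambda>\<close> is the
  union of a continuous well-ordered chain of sets \<open>\<Gamma>\<close> with \<open>\<phi>(X_\<Gamma>) = X_\<Gamma> \<inter> Im \<phi>\<close>, starting from the
  empty set, whose successive differences have at most \<open>\<kappa>\<close> elements. For successive \<open>\<Gamma> \<subseteq> \<Gamma>'\<close>, the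
  endomorphism induced on \<open>X_\<Gamma>' / X_\<Gamma>\<close> has a direct summand as image, hence a section of its
  cokernel, and a section of \<open>X_\<Gamma> \<rightarrow> X_\<Gamma> / \<phi>(X_\<Gamma>)\<close> thereby extends to one for \<open>\<Gamma>'\<close>. In the union the
  cokernel of \<open>\<phi>\<close> has a section, so that \<open>Im \<phi>\<close> is a direct summand.
\<close>

definition sigma_d_rickart :: "('a, 'r) ring_scheme \<Rightarrow> ('a, 'x, 'm) rmodule_scheme \<Rightarrow> bool"
  where "sigma_d_rickart A X \<longleftrightarrow>
    (\<forall>\<Lambda> :: ('x + nat) set. \<Lambda> \<noteq> {} \<longrightarrow> d_rickart A (copower X \<Lambda>))"


section \<open>Projective modules\<close>

text \<open>
  The lifting property. The types of \<open>M\<close> and \<open>N\<close> have to be fixed here; they accommodate the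
  canonical surjection from the free module on the set \<open>X\<close> onto \<open>X\<close>, so the property for modules of
  arbitrary types follows, see \<open>projective_lift\<close> below.
\<close>

definition projective :: "('a, 'r) ring_scheme \<Rightarrow> ('a, 'x, 'm) rmodule_scheme \<Rightarrow> bool"
  where "projective A X \<longleftrightarrow>
    (\<forall>(M :: ('a, 'x \<Rightarrow> 'a) rmodule) (N :: ('a, 'x) rmodule). \<forall>g\<in>rmod_hom A M N. \<forall>f\<in>rmod_hom A X N.
      right_module A M \<longrightarrow> right_module A N \<longrightarrow> g ` carrier M = carrier N \<longrightarrow>
      (\<exists>h\<in>rmod_hom A X M. \<forall>x\<in>carrier X. g (h x) = f x))"

definition regular_rmodule :: "('a, 'r) ring_scheme \<Rightarrow> ('a, 'a) rmodule"
  where "regular_rmodule A =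
    \<lparr>carrier = carrier A, mult = undefined, one = undefined, zero = \<zero>\<^bsub>A\<^esub>,
     add = add A, ract = mult A\<rparr>"

lemma rmod_homD:
  assumes "f \<in> rmod_hom A M N"
  shows "f \<in> carrier M \<rightarrow>\<^sub>E carrier N"
    and "x \<in> carrier M \<Longrightarrow> f x \<in> carrier N"
    and "\<lbrakk>x \<in> carrier M; y \<in> carrier M\<rbrakk> \<Longrightarrow> f (x \<oplus>\<^bsub>M\<^esub> y) = f x \<oplus>\<^bsub>N\<^esub> f y"
    and "\<lbrakk>x \<in> carrier M; a \<in> carrier A\<rbrakk> \<Longrightarrow> f (x \<cdot>\<^bsub>M\<^esub> a) = f x \<cdot>\<^bsub>N\<^esub> a"
  using assms by (auto simp: rmod_hom_def)

lemma (in right_module) ract_zero [simp]: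
  assumes "a \<in> carrier A" shows "\<zero>\<^bsub>M\<^esub> \<cdot>\<^bsub>M\<^esub> a = \<zero>\<^bsub>M\<^esub>"
  using ract_add[of "\<zero>\<^bsub>M\<^esub>" "\<zero>\<^bsub>M\<^esub>" a] assms
  by (metis M.add.l_cancel_one' M.zero_closed M.l_zero ract_closed)

lemma (in right_module) ract_zero_ring [simp]:
  assumes "x \<in> carrier M" shows "x \<cdot>\<^bsub>M\<^esub> \<zero>\<^bsub>A\<^esub> = \<zero>\<^bsub>M\<^esub>"
  using ract_add_ring[of x "\<zero>\<^bsub>A\<^esub>" "\<zero>\<^bsub>A\<^esub>"] assms
  by (metis M.add.l_cancel_one' A.zero_closed A.l_zero ract_closed)

lemma (in right_module) finsum_ract:
  assumes "finite I" "m \<in> I \<rightarrow> carrier M" "a \<in> carrier A"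
  shows "(\<Oplus>\<^bsub>M\<^esub>i\<in>I. m i) \<cdot>\<^bsub>M\<^esub> a = (\<Oplus>\<^bsub>M\<^esub>i\<in>I. m i \<cdot>\<^bsub>M\<^esub> a)"
  using assms(1,2)
proof (induction I rule: finite_induct)
  case empty
  then show ?case using assms(3) by simp
next
  case (insert j I)
  have 1: "m \<in> I \<rightarrow> carrier M" "m j \<in> carrier M" using insert.prems by auto
  have 2: "(\<lambda>i. m i \<cdot>\<^bsub>M\<^esub> a) \<in> I \<rightarrow> carrier M" using 1 assms(3) by auto
  show ?case
    using insert 1 2 assms(3) by (simp add: M.finsum_insert M.finsum_closed ract_add)
qed

lemma (in right_module) right_module_copower:
  fixes \<Lambda> :: "'i set"
  shows "right_module A (copower M \<Lambda>)"
proof -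
  have cl: "u \<in> \<Lambda> \<rightarrow>\<^sub>E carrier M \<Longrightarrow> i \<in> \<Lambda> \<Longrightarrow> u i \<in> carrier M" for u :: "'i \<Rightarrow> 'x" and i
    by auto
  have fin: "finite {i \<in> \<Lambda>. u i \<oplus>\<^bsub>M\<^esub> v i \<noteq> \<zero>\<^bsub>M\<^esub>}"
    if "finite {i \<in> \<Lambda>. u i \<noteq> \<zero>\<^bsub>M\<^esub>}" "finite {i \<in> \<Lambda>. v i \<noteq> \<zero>\<^bsub>M\<^esub>}" for u v :: "'i \<Rightarrow> 'x"
    by (rule finite_subset[OF _ finite_UnI[OF that]]) auto
  have fin_ract: "finite {i \<in> \<Lambda>. u i \<cdot>\<^bsub>M\<^esub> a \<noteq> \<zero>\<^bsub>M\<^esub>}"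
    if "finite {i \<in> \<Lambda>. u i \<noteq> \<zero>\<^bsub>M\<^esub>}" "a \<in> carrier A" for u :: "'i \<Rightarrow> 'x" and a
    by (rule finite_subset[OF _ that(1)]) (use that(2) in auto)
  have grp: "abelian_group (copower M \<Lambda>)"
  proof (rule abelian_groupI)
    fix u v w
    assume u: "u \<in> carrier (copower M \<Lambda>)" and v: "v \<in> carrier (copower M \<Lambda>)"
      and w: "w \<in> carrier (copower M \<Lambda>)"
    show "u \<oplus>\<^bsub>copower M \<Lambda>\<^esub> v \<oplus>\<^bsub>copower M \<Lambda>\<^esub> w = u \<oplus>\<^bsub>copower M \<Lambda>\<^esub> (v \<oplus>\<^bsub>copower M \<Lambda>\<^esub> w)"
      using u v w by (auto simp: copower_def cl M.a_assoc intro!: restrict_ext)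
  next
    fix u v assume u: "u \<in> carrier (copower M \<Lambda>)" and v: "v \<in> carrier (copower M \<Lambda>)"
    show "u \<oplus>\<^bsub>copower M \<Lambda>\<^esub> v \<in> carrier (copower M \<Lambda>)"
      using u v fin by (auto simp: copower_def cl cong: conj_cong)
    show "u \<oplus>\<^bsub>copower M \<Lambda>\<^esub> v = v \<oplus>\<^bsub>copower M \<Lambda>\<^esub> u"
      using u v by (auto simp: copower_def cl M.a_comm intro!: restrict_ext)
  next
    show "\<zero>\<^bsub>copower M \<Lambda>\<^esub> \<in> carrier (copower M \<Lambda>)"
      by (auto simp: copower_def cong: conj_cong)
  next
    fix u assume u: "u \<in> carrier (copower M \<Lambda>)"
    show "\<zero>\<^bsub>copower M \<Lambda>\<^esub> \<oplus>\<^bsub>copower M \<Lambda>\<^esub> u = u"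
      using u by (auto simp: copower_def cl intro!: ext)
        (metis PiE_arb restrict_def)
    let ?v = "\<lambda>i\<in>\<Lambda>. \<ominus>\<^bsub>M\<^esub> u i"
    have "finite {i \<in> \<Lambda>. ?v i \<noteq> \<zero>\<^bsub>M\<^esub>}"
      by (rule finite_subset[of _ "{i \<in> \<Lambda>. u i \<noteq> \<zero>\<^bsub>M\<^esub>}"]) (use u in \<open>auto simp: copower_def\<close>)
    then have "?v \<in> carrier (copower M \<Lambda>)"
      using u by (auto simp: copower_def cl)
    moreover have "?v \<oplus>\<^bsub>copower M \<Lambda>\<^esub> u = \<zero>\<^bsub>copower M \<Lambda>\<^esub>"
      using u by (auto simp: copower_def cl M.l_neg intro!: restrict_ext)
    ultimately show "\<exists>v\<in>carrier (copower M \<Lambda>). v \<oplus>\<^bsub>copower M \<Lambda>\<^esub> u = \<zero>\<^bsub>copower M \<Lambda>\<^esub>"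
      by blast
  qed
  show ?thesis
  proof (intro right_module.intro right_module_axioms.intro grp A.ring_axioms)
    fix u a b assume u: "u \<in> carrier (copower M \<Lambda>)" and a: "a \<in> carrier A" and b: "b \<in> carrier A"
    show "u \<cdot>\<^bsub>copower M \<Lambda>\<^esub> a \<in> carrier (copower M \<Lambda>)"
      using u a fin_ract by (auto simp: copower_def cl cong: conj_cong)
    show "u \<cdot>\<^bsub>copower M \<Lambda>\<^esub> (a \<oplus>\<^bsub>A\<^esub> b)
        = u \<cdot>\<^bsub>copower M \<Lambda>\<^esub> a \<oplus>\<^bsub>copower M \<Lambda>\<^esub> u \<cdot>\<^bsub>copower M \<Lambda>\<^esub> b"
      using u a b by (auto simp: copower_def cl ract_add_ring intro!: restrict_ext)
    show "u \<cdot>\<^bsub>copower M \<Lambda>\<^esub> (a \<otimes>\<^bsub>A\<^esub> b) = u \<cdot>\<^bsub>copower M \<Lambda>\<^esub> a \<cdot>\<^bsub>copower M \<Lambda>\<^esub> b"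
      using u a b by (auto simp: copower_def cl ract_assoc intro!: restrict_ext)
  next
    fix u v a
    assume "u \<in> carrier (copower M \<Lambda>)" "v \<in> carrier (copower M \<Lambda>)" "a \<in> carrier A"
    then show "(u \<oplus>\<^bsub>copower M \<Lambda>\<^esub> v) \<cdot>\<^bsub>copower M \<Lambda>\<^esub> a
        = u \<cdot>\<^bsub>copower M \<Lambda>\<^esub> a \<oplus>\<^bsub>copower M \<Lambda>\<^esub> v \<cdot>\<^bsub>copower M \<Lambda>\<^esub> a"
      by (auto simp: copower_def cl ract_add intro!: restrict_ext)
  next
    fix u assume "u \<in> carrier (copower M \<Lambda>)"
    then show "u \<cdot>\<^bsub>copower M \<Lambda>\<^esub> \<one>\<^bsub>A\<^esub> = u"
      by (auto simp: copower_def cl intro!: ext) (metis PiE_arb restrict_def)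
  qed
qed

lemma right_module_regular:
  assumes "ring A" shows "right_module A (regular_rmodule A)"
proof -
  interpret ring A by fact
  have "abelian_group (regular_rmodule A)"
    by (rule abelian_groupI)
      (auto simp: regular_rmodule_def a_ac intro: l_neg bexI[of _ "\<ominus>\<^bsub>A\<^esub> _"])
  then show ?thesis
    by (intro right_module.intro right_module_axioms.intro ring_axioms)
      (auto simp: regular_rmodule_def r_distr l_distr m_assoc)
qed

lemma free_rmodule_hom:
  assumes "right_module A M" and m: "m \<in> I \<rightarrow> carrier M"
  defines "F \<equiv> copower (regular_rmodule A) I"
  shows "(\<lambda>u\<in>carrier F. \<Oplus>\<^bsub>M\<^esub>i\<in>{i \<in> I. u i \<noteq> \<zero>\<^bsub>A\<^esub>}. m i \<cdot>\<^bsub>M\<^esub> u i) \<in> rmod_hom A F M"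
    (is "?k \<in> _")
proof -
  interpret right_module A M by fact
  interpret reg: right_module A "regular_rmodule A"
    by (rule right_module_regular) (rule A.ring_axioms)
  interpret F: right_module A F unfolding F_def by (rule reg.right_module_copower)
  let ?s = "\<lambda>u. {i \<in> I. u i \<noteq> \<zero>\<^bsub>A\<^esub>}"
  have F: "finite (?s u)" "i \<in> I \<Longrightarrow> u i \<in> carrier A" if "u \<in> carrier F" for u i
    using that by (auto simp: F_def copower_def regular_rmodule_def)
  have F_add: "(u \<oplus>\<^bsub>F\<^esub> v) i = u i \<oplus>\<^bsub>A\<^esub> v i" if "i \<in> I" for u v i
    using that by (simp add: F_def copower_def regular_rmodule_def)
  have F_ract: "(u \<cdot>\<^bsub>F\<^esub> a) i = u i \<otimes>\<^bsub>A\<^esub> a" if "i \<in> I" for u a i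
    using that by (simp add: F_def copower_def regular_rmodule_def)
  have mc: "m i \<in> carrier M" if "i \<in> I" for i using m that by auto
  have k_eq: "?k u = (\<Oplus>\<^bsub>M\<^esub>i\<in>J. m i \<cdot>\<^bsub>M\<^esub> u i)"
    if u: "u \<in> carrier F" and J: "finite J" "?s u \<subseteq> J" "J \<subseteq> I" for u J
  proof -
    have "(\<Oplus>\<^bsub>M\<^esub>i\<in>?s u. m i \<cdot>\<^bsub>M\<^esub> u i) = (\<Oplus>\<^bsub>M\<^esub>i\<in>J. m i \<cdot>\<^bsub>M\<^esub> u i)"
    proof (rule M.add.finprod_mono_neutral_cong_left)
      show "m i \<cdot>\<^bsub>M\<^esub> u i = \<zero>\<^bsub>M\<^esub>" if "i \<in> J - ?s u" for i
        using that J mc by auto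
      show "(\<lambda>i. m i \<cdot>\<^bsub>M\<^esub> u i) \<in> J \<rightarrow> carrier M"
        using J mc F(2)[OF u] by auto
    qed (use J in auto)
    then show ?thesis using u by simp
  qed
  have cl: "(\<lambda>i. m i \<cdot>\<^bsub>M\<^esub> u i) \<in> J \<rightarrow> carrier M" if "u \<in> carrier F" "J \<subseteq> I" for u J
    using that mc F(2) by auto
  show ?thesis
    unfolding rmod_hom_def
  proof (intro CollectI conjI ballI)
    show "?k \<in> carrier F \<rightarrow>\<^sub>E carrier M"
      using cl by (auto intro!: M.finsum_closed)
  next
    fix u v assume u: "u \<in> carrier F" and v: "v \<in> carrier F"
    let ?J = "?s u \<union> ?s v"
    have uv: "u \<oplus>\<^bsub>F\<^esub> v \<in> carrier F" using u v by simp
    have J: "finite ?J" "?J \<subseteq> I" using F(1) u v by auto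
    have "?k (u \<oplus>\<^bsub>F\<^esub> v) = (\<Oplus>\<^bsub>M\<^esub>i\<in>?J. m i \<cdot>\<^bsub>M\<^esub> (u \<oplus>\<^bsub>F\<^esub> v) i)"
      by (rule k_eq) (use uv J F_add in auto)
    also have "\<dots> = (\<Oplus>\<^bsub>M\<^esub>i\<in>?J. m i \<cdot>\<^bsub>M\<^esub> u i \<oplus>\<^bsub>M\<^esub> m i \<cdot>\<^bsub>M\<^esub> v i)"
      using u v mc F(2) F_add by (intro M.finsum_cong') (auto simp: ract_add_ring)
    also have "\<dots> = (\<Oplus>\<^bsub>M\<^esub>i\<in>?J. m i \<cdot>\<^bsub>M\<^esub> u i) \<oplus>\<^bsub>M\<^esub> (\<Oplus>\<^bsub>M\<^esub>i\<in>?J. m i \<cdot>\<^bsub>M\<^esub> v i)"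
      by (rule M.finsum_addf) (use u v cl J in auto)
    also have "\<dots> = ?k u \<oplus>\<^bsub>M\<^esub> ?k v"
      using k_eq[OF u, of ?J] k_eq[OF v, of ?J] J by simp
    finally show "?k (u \<oplus>\<^bsub>F\<^esub> v) = ?k u \<oplus>\<^bsub>M\<^esub> ?k v" .
  next
    fix u a assume u: "u \<in> carrier F" and a: "a \<in> carrier A"
    have ua: "u \<cdot>\<^bsub>F\<^esub> a \<in> carrier F" using u a by simp
    have "?k (u \<cdot>\<^bsub>F\<^esub> a) = (\<Oplus>\<^bsub>M\<^esub>i\<in>?s u. m i \<cdot>\<^bsub>M\<^esub> (u \<cdot>\<^bsub>F\<^esub> a) i)"
      by (rule k_eq) (use ua a F[OF u] F_ract in auto)
    also have "\<dots> = (\<Oplus>\<^bsub>M\<^esub>i\<in>?s u. (m i \<cdot>\<^bsub>M\<^esub> u i) \<cdot>\<^bsub>M\<^esub> a)"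
      using u a mc F(2) F_ract by (intro M.finsum_cong') (auto simp: ract_assoc)
    also have "\<dots> = ?k u \<cdot>\<^bsub>M\<^esub> a"
      using finsum_ract[of "?s u" "\<lambda>i. m i \<cdot>\<^bsub>M\<^esub> u i" a] u a F(1) cl[of u "?s u"] by simp
    finally show "?k (u \<cdot>\<^bsub>F\<^esub> a) = ?k u \<cdot>\<^bsub>M\<^esub> a" .
  qed
qed

lemma rmod_hom_zero:
  assumes "right_module A M" "right_module A N" "g \<in> rmod_hom A M N"
  shows "g \<zero>\<^bsub>M\<^esub> = \<zero>\<^bsub>N\<^esub>"
proof -
  interpret M: right_module A M by fact
  interpret N: right_module A N by fact
  have "g \<zero>\<^bsub>M\<^esub> \<cdot>\<^bsub>N\<^esub> \<zero>\<^bsub>A\<^esub> = g (\<zero>\<^bsub>M\<^esub> \<cdot>\<^bsub>M\<^esub> \<zero>\<^bsub>A\<^esub>)"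
    using rmod_homD(4)[OF assms(3) M.M.zero_closed M.A.zero_closed] by (rule sym)
  then show ?thesis using rmod_homD(2)[OF assms(3)] by simp
qed

lemma rmod_hom_finsum:
  assumes "right_module A M" "right_module A N" "g \<in> rmod_hom A M N"
    and "finite I" "m \<in> I \<rightarrow> carrier M"
  shows "g (\<Oplus>\<^bsub>M\<^esub>i\<in>I. m i) = (\<Oplus>\<^bsub>N\<^esub>i\<in>I. g (m i))"
proof -
  interpret M: right_module A M by fact
  interpret N: right_module A N by fact
  note g = rmod_homD[OF assms(3)]
  show ?thesis
    using assms(4,5)
  proof (induction I rule: finite_induct)
    case empty
    then show ?case using rmod_hom_zero[OF assms(1-3)] by simp
  next
    case (insert j I)
    have 1: "m \<in> I \<rightarrow> carrier M" "m j \<in> carrier M" using insert.prems by auto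
    have 2: "(\<lambda>i. g (m i)) \<in> I \<rightarrow> carrier N" using 1 g(2) by auto
    show ?case
      using insert 1 2 g(2) by (simp add: M.M.finsum_insert N.M.finsum_insert M.M.finsum_closed g(3))
  qed
qed

theorem projective_lift:
  fixes X :: "('a, 'x, 'm) rmodule_scheme"
    and M :: "('a, 'y, 'p) rmodule_scheme" and N :: "('a, 'z, 'q) rmodule_scheme"
  assumes X: "right_module A X" and proj: "projective A X"
    and M: "right_module A M" and N: "right_module A N"
    and g: "g \<in> rmod_hom A M N" and surj: "g ` carrier M = carrier N"
    and f: "f \<in> rmod_hom A X N"
  shows "\<exists>h\<in>rmod_hom A X M. \<forall>x\<in>carrier X. g (h x) = f x"
proof -
  interpret X: right_module A X by fact
  interpret M: right_module A M by fact
  interpret N: right_module A N by fact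
  define F where "F = copower (regular_rmodule A) (carrier X)"
  define e where "e = (\<lambda>u\<in>carrier F. \<Oplus>\<^bsub>X\<^esub>x\<in>{x \<in> carrier X. u x \<noteq> \<zero>\<^bsub>A\<^esub>}. x \<cdot>\<^bsub>X\<^esub> u x)"
  have e: "e \<in> rmod_hom A F X"
    using free_rmodule_hom[OF X, of "\<lambda>x. x" "carrier X"] by (simp add: e_def F_def)
  have F: "right_module A F"
    unfolding F_def
    by (intro right_module.right_module_copower right_module_regular X.A.ring_axioms)
  have "\<exists>u\<in>carrier F. e u = x" if x: "x \<in> carrier X" for x
  proof (cases "\<one>\<^bsub>A\<^esub> = \<zero>\<^bsub>A\<^esub>")
    case True
    interpret F: right_module A F by fact
    have "x = \<zero>\<^bsub>X\<^esub>" using X.ract_one[OF x] X.ract_zero_ring[OF x] True by simp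
    then show ?thesis using rmod_hom_zero[OF F X e] F.M.zero_closed by blast
  next
    case False
    define u where "u = (\<lambda>y\<in>carrier X. if y = x then \<one>\<^bsub>A\<^esub> else \<zero>\<^bsub>A\<^esub>)"
    have s: "{y \<in> carrier X. u y \<noteq> \<zero>\<^bsub>A\<^esub>} = {x}"
      using False x by (auto simp: u_def)
    have u: "u \<in> carrier F"
      using s by (auto simp: F_def copower_def regular_rmodule_def u_def)
    have "e u = x"
      using u x s by (simp add: e_def) (simp add: u_def)
    then show ?thesis using u by blast
  qed
  then have e_surj: "e ` carrier F = carrier X"
    using rmod_homD(2)[OF e] by auto
  define X' :: "('a, 'x) rmodule" where "X' = \<lparr>carrier = carrier X, mult = undefined, one = undefined,
    zero = \<zero>\<^bsub>X\<^esub>, add = add X, ract = ract X\<rparr>"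
  have "abelian_group X'"
    unfolding X'_def
    by (rule abelian_groupI) (auto simp: X.M.a_ac intro: X.M.l_neg bexI[of _ "\<ominus>\<^bsub>X\<^esub> _"])
  then have X': "right_module A X'"
    by (intro right_module.intro right_module_axioms.intro X.A.ring_axioms)
      (auto simp: X'_def X.ract_add X.ract_add_ring X.ract_assoc)
  have e': "e \<in> rmod_hom A F X'" "e ` carrier F = carrier X'"
    using e e_surj by (auto simp: rmod_hom_def X'_def)
  have id': "(\<lambda>x\<in>carrier X. x) \<in> rmod_hom A X X'"
    by (auto simp: rmod_hom_def X'_def)
  have "\<exists>s\<in>rmod_hom A X F. \<forall>x\<in>carrier X. e (s x) = (\<lambda>x\<in>carrier X. x) x"
    using proj[unfolded projective_def, rule_format, OF e'(1) id' F X' e'(2)] .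
  then obtain s where s: "s \<in> rmod_hom A X F"
    and s_id: "\<forall>x\<in>carrier X. e (s x) = (\<lambda>x\<in>carrier X. x) x" by (elim bexE)
  have es: "e (s x) = x" if x: "x \<in> carrier X" for x
    by (rule trans[OF bspec[OF s_id x] restrict_apply'[OF x]])
  define m where "m x = (SOME y. y \<in> carrier M \<and> g y = f x)" for x
  have m: "m x \<in> carrier M \<and> g (m x) = f x" if "x \<in> carrier X" for x
  proof -
    have "f x \<in> g ` carrier M" using rmod_homD(2)[OF f that] by (simp only: surj)
    then have "\<exists>y. y \<in> carrier M \<and> g y = f x"
      by (metis imageE)
    then show ?thesis unfolding m_def by (rule someI_ex)
  qed
  define k where "k = (\<lambda>u\<in>carrier F. \<Oplus>\<^bsub>M\<^esub>x\<in>{x \<in> carrier X. u x \<noteq> \<zero>\<^bsub>A\<^esub>}. m x \<cdot>\<^bsub>M\<^esub> u x)"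
  have k: "k \<in> rmod_hom A F M"
    using free_rmodule_hom[OF M, of m "carrier X"] m by (simp add: k_def F_def)
  have gk: "g (k u) = f (e u)" if u: "u \<in> carrier F" for u
  proof -
    let ?s = "{x \<in> carrier X. u x \<noteq> \<zero>\<^bsub>A\<^esub>}"
    have fin: "finite ?s" and uc: "\<And>x. x \<in> carrier X \<Longrightarrow> u x \<in> carrier A"
      using u by (auto simp: F_def copower_def regular_rmodule_def)
    have "g (k u) = (\<Oplus>\<^bsub>N\<^esub>x\<in>?s. g (m x \<cdot>\<^bsub>M\<^esub> u x))"
      using u m uc by (simp add: k_def) (rule rmod_hom_finsum[OF M N g fin], auto)
    also have "\<dots> = (\<Oplus>\<^bsub>N\<^esub>x\<in>?s. f (x \<cdot>\<^bsub>X\<^esub> u x))"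
      using m uc rmod_homD(2,4)[OF f] rmod_homD(4)[OF g]
      by (intro N.M.finsum_cong') auto
    also have "\<dots> = f (e u)"
      using u uc by (simp add: e_def) (rule rmod_hom_finsum[OF X N f fin, symmetric], auto)
    finally show ?thesis .
  qed
  let ?h = "compose (carrier X) k s"
  have "?h \<in> rmod_hom A X M"
    using rmod_homD(2-4)[OF s] rmod_homD(2-4)[OF k]
    by (auto simp: rmod_hom_def compose_def)
  moreover have "\<forall>x\<in>carrier X. g (?h x) = f x"
    using gk es rmod_homD(2)[OF s] by (simp add: compose_def)
  ultimately show ?thesis by (intro bexI[where x = ?h])
qed

end

theory Submission
  imports Defs
begin

text \<open>
  A single copy of \<open>X\<close> suffices. The image of \<open>s \<in> S\<close> is a direct summand, so \<open>X\<close> has a projection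
  \<open>p\<close> onto it; lifting \<open>p\<close> along the surjection \<open>s : X \<rightarrow> Im s\<close> gives \<open>t\<close> with \<open>s t = p\<close>,
  hence \<open>s t s = p s = s\<close>.
\<close>

section \<open>Submodules and projections onto direct summands\<close>

lemma (in right_module) ract_minus:
  assumes "x \<in> carrier M" "a \<in> carrier A"
  shows "(\<ominus>\<^bsub>M\<^esub> x) \<cdot>\<^bsub>M\<^esub> a = \<ominus>\<^bsub>M\<^esub> (x \<cdot>\<^bsub>M\<^esub> a)"
proof -
  have "(\<ominus>\<^bsub>M\<^esub> x) \<cdot>\<^bsub>M\<^esub> a \<oplus>\<^bsub>M\<^esub> x \<cdot>\<^bsub>M\<^esub> a = \<zero>\<^bsub>M\<^esub>"
    using assms by (simp add: ract_add[symmetric] M.l_neg)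
  then show ?thesis
    using assms by (intro M.minus_equality[symmetric]) auto
qed

lemma (in right_module) rsubmoduleD:
  assumes "rsubmodule A M N"
  shows "N \<subseteq> carrier M" and "\<zero>\<^bsub>M\<^esub> \<in> N"
    and "\<lbrakk>x \<in> N; y \<in> N\<rbrakk> \<Longrightarrow> x \<oplus>\<^bsub>M\<^esub> y \<in> N" and "x \<in> N \<Longrightarrow> \<ominus>\<^bsub>M\<^esub> x \<in> N"
    and "\<lbrakk>x \<in> N; a \<in> carrier A\<rbrakk> \<Longrightarrow> x \<cdot>\<^bsub>M\<^esub> a \<in> N"
proof -
  have sub: "subgroup N (add_monoid M)" and act: "\<forall>x\<in>N. \<forall>a\<in>carrier A. x \<cdot>\<^bsub>M\<^esub> a \<in> N"
    using assms by (auto simp: rsubmodule_def)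
  show "N \<subseteq> carrier M" "\<zero>\<^bsub>M\<^esub> \<in> N"
    "\<lbrakk>x \<in> N; y \<in> N\<rbrakk> \<Longrightarrow> x \<oplus>\<^bsub>M\<^esub> y \<in> N"
    using subgroup.subset[OF sub] subgroup.one_closed[OF sub] subgroup.m_closed[OF sub, of x y]
    by auto
  show "x \<in> N \<Longrightarrow> \<ominus>\<^bsub>M\<^esub> x \<in> N"
    using subgroup.m_inv_closed[OF sub, of x] by (simp add: a_inv_def)
  show "\<lbrakk>x \<in> N; a \<in> carrier A\<rbrakk> \<Longrightarrow> x \<cdot>\<^bsub>M\<^esub> a \<in> N"
    using act by blast
qed

text \<open>Lifting along a surjection onto an image needs that image as a module in its own right.
  Shrinking the carrier keeps all operations of \<open>M\<close>, so only closure has to be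
  checked.\<close>

lemma (in right_module) right_module_rsubmodule:
  assumes "rsubmodule A M N"
  shows "right_module A (M\<lparr>carrier := N\<rparr>)"
proof -
  note N = rsubmoduleD[OF assms]
  have cl: "x \<in> carrier M" if "x \<in> N" for x using N(1) that by blast
  have "abelian_group (M\<lparr>carrier := N\<rparr>)"
    by (rule abelian_groupI)
      (auto simp: N cl M.a_ac intro!: bexI[of _ "\<ominus>\<^bsub>M\<^esub> _"] M.r_neg)
  then show ?thesis
    by (intro right_module.intro right_module_axioms.intro A.ring_axioms)
      (auto simp: N cl ract_add ract_add_ring ract_assoc)
qed

text \<open>Each element splits uniquely along \<open>N\<close> and a complement, and
  \<open>p\<close> picks the \<open>N\<close>-component. The codomain is the module on
  \<open>N\<close> rather than \<open>M\<close>, so that \<open>p\<close> can be lifted along a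
  surjection onto \<open>N\<close>.\<close>

lemma (in right_module) direct_summand_projection:
  assumes "direct_summand A M N"
  shows "\<exists>p\<in>rmod_hom A M (M\<lparr>carrier := N\<rparr>). \<forall>x\<in>N. p x = x"
proof -
  obtain K where N: "rsubmodule A M N" and K: "rsubmodule A M K"
    and NK: "N \<inter> K = {\<zero>\<^bsub>M\<^esub>}" "N <+>\<^bsub>M\<^esub> K = carrier M"
    using assms by (auto simp: direct_summand_def)
  note Nc = rsubmoduleD[OF N] and Kc = rsubmoduleD[OF K]
  have cl: "x \<in> carrier M" if "x \<in> N \<or> x \<in> K" for x using Nc(1) Kc(1) that by blast
  have unique: "n = n'"
    if "n \<in> N" "n' \<in> N" "k \<in> K" "k' \<in> K" and eq: "n \<oplus>\<^bsub>M\<^esub> k = n' \<oplus>\<^bsub>M\<^esub> k'" for n n' k k'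
  proof -
    have nc: "n \<in> carrier M" "n' \<in> carrier M" "k \<in> carrier M" "k' \<in> carrier M"
      using that cl by auto
    have "n = (n \<oplus>\<^bsub>M\<^esub> k) \<oplus>\<^bsub>M\<^esub> \<ominus>\<^bsub>M\<^esub> k"
      using nc by (simp add: M.a_assoc M.r_neg)
    also have "\<dots> = n' \<oplus>\<^bsub>M\<^esub> (k' \<oplus>\<^bsub>M\<^esub> \<ominus>\<^bsub>M\<^esub> k)"
      using nc by (simp add: eq M.a_assoc)
    \<comment> \<open>Move everything from \<open>N\<close> to the left and everything from
      \<open>K\<close> to the right: the common value lies in the intersection and vanishes.\<close>
    finally have "\<ominus>\<^bsub>M\<^esub> n' \<oplus>\<^bsub>M\<^esub> n = k' \<oplus>\<^bsub>M\<^esub> \<ominus>\<^bsub>M\<^esub> k"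
      using nc M.r_neg1[of n' "k' \<oplus>\<^bsub>M\<^esub> \<ominus>\<^bsub>M\<^esub> k"] by simp
    moreover have "\<ominus>\<^bsub>M\<^esub> n' \<oplus>\<^bsub>M\<^esub> n \<in> N" "k' \<oplus>\<^bsub>M\<^esub> \<ominus>\<^bsub>M\<^esub> k \<in> K"
      using that(1-4) by (simp_all add: Nc Kc)
    ultimately have "\<ominus>\<^bsub>M\<^esub> n' \<oplus>\<^bsub>M\<^esub> n = \<zero>\<^bsub>M\<^esub>"
      using NK(1) by auto
    then have "\<ominus>\<^bsub>M\<^esub> n = \<ominus>\<^bsub>M\<^esub> n'"
      using nc by (intro M.minus_equality) auto
    then show ?thesis using nc M.minus_minus by metis
  qed
  define p where
    "p = (\<lambda>x\<in>carrier M. THE n. n \<in> N \<and> (\<exists>k\<in>K. x = n \<oplus>\<^bsub>M\<^esub> k))"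
  have p_eq: "p (n \<oplus>\<^bsub>M\<^esub> k) = n" if "n \<in> N" "k \<in> K" for n k
  proof -
    have "(THE n'. n' \<in> N \<and> (\<exists>k'\<in>K. n \<oplus>\<^bsub>M\<^esub> k = n' \<oplus>\<^bsub>M\<^esub> k')) = n"
      using that unique by (intro the_equality) blast+
    then show ?thesis using that cl by (simp add: p_def)
  qed
  have decomp: "\<exists>n\<in>N. \<exists>k\<in>K. x = n \<oplus>\<^bsub>M\<^esub> k" if "x \<in> carrier M" for x
  proof -
    have "x \<in> N <+>\<^bsub>M\<^esub> K" using that NK(2) by simp
    then show ?thesis by (auto simp: set_add_def')
  qed
  have "p \<in> rmod_hom A M (M\<lparr>carrier := N\<rparr>)"
    unfolding rmod_hom_def
  proof (intro CollectI conjI ballI)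
    show "p \<in> carrier M \<rightarrow>\<^sub>E carrier (M\<lparr>carrier := N\<rparr>)"
    proof (rule PiE_I)
      show "p x \<in> carrier (M\<lparr>carrier := N\<rparr>)" if "x \<in> carrier M" for x
        using decomp[OF that] p_eq by auto
    qed (simp add: p_def)
  next
    fix x y assume "x \<in> carrier M" "y \<in> carrier M"
    then obtain n k n' k' where nk: "n \<in> N" "k \<in> K" "n' \<in> N" "k' \<in> K"
      and xy: "x = n \<oplus>\<^bsub>M\<^esub> k" "y = n' \<oplus>\<^bsub>M\<^esub> k'"
      using decomp by meson
    \<comment> \<open>Regroup so that \<open>p_eq\<close> applies to the sum as a whole.
      \<open>p\<close> is evaluated on this form first; x and y are replaced by their own
      decompositions only afterwards.\<close>
    have "x \<oplus>\<^bsub>M\<^esub> y = (n \<oplus>\<^bsub>M\<^esub> n') \<oplus>\<^bsub>M\<^esub> (k \<oplus>\<^bsub>M\<^esub> k')"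
      using nk cl by (simp add: xy M.a_ac)
    then show "p (x \<oplus>\<^bsub>M\<^esub> y) = p x \<oplus>\<^bsub>M\<lparr>carrier := N\<rparr>\<^esub> p y"
      using nk by (simp add: p_eq Nc Kc) (simp add: xy p_eq)
  next
    fix x a assume "x \<in> carrier M" and a: "a \<in> carrier A"
    then obtain n k where nk: "n \<in> N" "k \<in> K" and x: "x = n \<oplus>\<^bsub>M\<^esub> k"
      using decomp by meson
    have "x \<cdot>\<^bsub>M\<^esub> a = n \<cdot>\<^bsub>M\<^esub> a \<oplus>\<^bsub>M\<^esub> k \<cdot>\<^bsub>M\<^esub> a"
      using nk cl a by (simp add: x ract_add)
    then show "p (x \<cdot>\<^bsub>M\<^esub> a) = p x \<cdot>\<^bsub>M\<lparr>carrier := N\<rparr>\<^esub> a"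
      using nk a by (simp add: p_eq Nc Kc) (simp add: x p_eq)
  qed
  moreover have "\<forall>x\<in>N. p x = x"
    \<comment> \<open>Here x is decomposed as x plus zero, with zero taken from
      \<open>K\<close>.\<close>
    using p_eq[OF _ Kc(2)] cl by simp
  ultimately show ?thesis by blast
qed

section \<open>Homomorphisms and the endomorphism ring\<close>

lemma rmod_hom_restrictI:
  assumes "right_module A M"
    and "\<And>x. x \<in> carrier M \<Longrightarrow> f x \<in> carrier N"
    and "\<And>x y. \<lbrakk>x \<in> carrier M; y \<in> carrier M\<rbrakk> \<Longrightarrow> f (x \<oplus>\<^bsub>M\<^esub> y) = f x \<oplus>\<^bsub>N\<^esub> f y"
    and "\<And>x a. \<lbrakk>x \<in> carrier M; a \<in> carrier A\<rbrakk> \<Longrightarrow> f (x \<cdot>\<^bsub>M\<^esub> a) = f x \<cdot>\<^bsub>N\<^esub> a"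
  shows "(\<lambda>x\<in>carrier M. f x) \<in> rmod_hom A M N"
proof -
  interpret right_module A M by fact
  show ?thesis using assms(2-4) by (auto simp: rmod_hom_def)
qed

lemma rmod_hom_eqI:
  assumes "f \<in> rmod_hom A M N" "g \<in> rmod_hom A M N" "\<And>x. x \<in> carrier M \<Longrightarrow> f x = g x"
  shows "f = g"
  using assms by (intro PiE_ext[OF rmod_homD(1) rmod_homD(1)])

lemma (in right_module) rmod_hom_compose:
  assumes "f \<in> rmod_hom A L N" "g \<in> rmod_hom A M L"
  shows "compose (carrier M) f g \<in> rmod_hom A M N"
  unfolding compose_def
  by (rule rmod_hom_restrictI[OF right_module_axioms])
    (simp_all add: rmod_homD(2-4)[OF assms(1)] rmod_homD(2-4)[OF assms(2)])

text \<open>Regularity as defined includes being a ring. Pointwise sums are again additive because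
  addition in \<open>M\<close> is commutative, and \<open>ract_minus\<close> makes pointwise
  negation linear. One distributive law holds pointwise by definition, the other is additivity of
  the outer map.\<close>

lemma (in right_module) ring_End_ring: "ring (End_ring A M)"
proof -
  let ?E = "rmod_hom A M M"
  note I = rmod_hom_restrictI[OF right_module_axioms]
  note d = rmod_homD(2-4)[of _ A M M]
  have add: "(\<lambda>x\<in>carrier M. f x \<oplus>\<^bsub>M\<^esub> g x) \<in> ?E" if "f \<in> ?E" "g \<in> ?E" for f g
    by (rule I) (simp_all add: d that M.a_ac ract_add)
  have neg: "(\<lambda>x\<in>carrier M. \<ominus>\<^bsub>M\<^esub> f x) \<in> ?E" if "f \<in> ?E" for f
    by (rule I) (simp_all add: d that M.minus_add ract_minus)
  have zero: "(\<lambda>x\<in>carrier M. \<zero>\<^bsub>M\<^esub>) \<in> ?E" and one: "(\<lambda>x\<in>carrier M. x) \<in> ?E"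
    by (rule I; simp)+
  have restrict: "restrict f (carrier M) = f" if "f \<in> ?E" for f
    using rmod_homD(1)[OF that] by (rule PiE_restrict)
  note E = add zero one rmod_hom_compose[of _ M M] restrict
  show ?thesis
  proof (rule ringI)
    show "abelian_group (End_ring A M)"
    proof (rule abelian_groupI)
      fix f assume f: "f \<in> carrier (End_ring A M)"
      let ?g = "\<lambda>x\<in>carrier M. \<ominus>\<^bsub>M\<^esub> f x"
      have "?g \<oplus>\<^bsub>End_ring A M\<^esub> f = \<zero>\<^bsub>End_ring A M\<^esub>"
        using f by (simp add: End_ring_def M.l_neg d cong: restrict_cong)
      then show "\<exists>g\<in>carrier (End_ring A M). g \<oplus>\<^bsub>End_ring A M\<^esub> f = \<zero>\<^bsub>End_ring A M\<^esub>"
        using neg f by (intro bexI[of _ ?g]) (auto simp: End_ring_def)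
    qed (auto simp: End_ring_def E d M.a_ac cong: restrict_cong intro!: rmod_hom_eqI[of _ A M M])
    show "monoid (End_ring A M)"
      by (rule monoidI)
        (auto simp: End_ring_def E d compose_eq intro!: rmod_hom_eqI[of _ A M M])
  qed (auto simp: End_ring_def E d compose_eq intro!: rmod_hom_eqI[of _ A M M])
qed

section \<open>Passage between a module and a single-index copower\<close>

lemma (in right_module) copower_single_hom:
  "(\<lambda>x\<in>carrier M. \<lambda>j\<in>{i}. x) \<in> rmod_hom A M (copower M {i})"
  by (rule rmod_hom_restrictI[OF right_module_axioms])
    (auto simp: copower_def intro: rev_finite_subset[of "{i}"])

text \<open>For a one-point \<open>\<Lambda>\<close> this undoes the embedding above. The two maps
  are needed because \<open>copower M {i}\<close> consists of functions on {i} and is only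
  isomorphic to \<open>M\<close>, not equal to it.\<close>

lemma (in right_module) copower_eval_hom:
  assumes "i \<in> \<Lambda>"
  shows "(\<lambda>u\<in>carrier (copower M \<Lambda>). u i) \<in> rmod_hom A (copower M \<Lambda>) M"
  by (rule rmod_hom_restrictI[OF right_module_copower])
    (use assms in \<open>auto simp: copower_def\<close>)

lemma rmod_hom_regular:
  fixes X :: "('a, 'x, 'm) rmodule_scheme" and i :: 'i
  assumes X: "right_module A X" and proj: "projective A X"
    and ric: "d_rickart A (copower X {i})" and s: "s \<in> rmod_hom A X X"
  shows "\<exists>t\<in>rmod_hom A X X. \<forall>x\<in>carrier X. s (t (s x)) = s x"
proof -
  interpret X: right_module A X by fact
  define M where "M = copower X {i}"
  interpret M: right_module A M
    unfolding M_def by (rule X.right_module_copower)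
  define \<iota> where "\<iota> = (\<lambda>x\<in>carrier X. \<lambda>j\<in>{i}. x)"
  define \<pi> where "\<pi> = (\<lambda>u\<in>carrier M. u i)"
  have \<iota>: "\<iota> \<in> rmod_hom A X M" and \<pi>: "\<pi> \<in> rmod_hom A M X"
    unfolding \<iota>_def \<pi>_def M_def
    by (rule X.copower_single_hom X.copower_eval_hom, simp?)+
  note \<iota>D = rmod_homD[OF \<iota>] and \<pi>D = rmod_homD[OF \<pi>] and sD = rmod_homD[OF s]
  have \<pi>\<iota>: "\<pi> (\<iota> x) = x" if "x \<in> carrier X" for x
    using that \<iota>D(2) by (simp add: \<pi>_def) (simp add: \<iota>_def)
  \<comment> \<open>The d-Rickart hypothesis speaks of endomorphisms of the copower, so s is
    transported there.\<close>
  define \<phi> where "\<phi> = compose (carrier M) (compose (carrier X) \<iota> s) \<pi>"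
  have \<phi>: "\<phi> \<in> rmod_hom A M M"
    unfolding \<phi>_def by (rule M.rmod_hom_compose[OF X.rmod_hom_compose[OF \<iota> s] \<pi>])
  have \<phi>_eq: "\<phi> u = \<iota> (s (\<pi> u))" if "u \<in> carrier M" for u
    using that \<pi>D(2) by (simp add: \<phi>_def compose_eq)
  define N where "N = M\<lparr>carrier := \<phi> ` carrier M\<rparr>"
  have summand: "direct_summand A M (\<phi> ` carrier M)"
    using ric \<phi> by (simp add: d_rickart_def M_def)
  then have N: "right_module A N"
    unfolding N_def by (intro M.right_module_rsubmodule) (simp add: direct_summand_def)
  obtain p where p: "p \<in> rmod_hom A M N" and p_id: "\<And>u. u \<in> \<phi> ` carrier M \<Longrightarrow> p u = u"
    using M.direct_summand_projection[OF summand] unfolding N_def by blast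
  have "\<phi> \<in> rmod_hom A M N"
    using \<phi> by (auto simp: rmod_hom_def N_def)
  moreover have "\<phi> ` carrier M = carrier N" by (simp add: N_def)
  \<comment> \<open>The lifting problem starts at X, the module known to be projective: the map
    \<open>p\<close> after \<open>\<iota>\<close>, from X to the image of \<open>\<phi>\<close>, is
    lifted along \<open>\<phi>\<close>.\<close>
  ultimately have "\<exists>h\<in>rmod_hom A X M. \<forall>x\<in>carrier X. \<phi> (h x) = compose (carrier X) p \<iota> x"
    by (rule projective_lift[OF X proj M.right_module_axioms N _ _ X.rmod_hom_compose[OF p \<iota>]])
  then obtain h where h: "h \<in> rmod_hom A X M"
    and h_lift: "\<And>x. x \<in> carrier X \<Longrightarrow> \<phi> (h x) = p (\<iota> x)"
    by (auto simp only: compose_eq)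
  \<comment> \<open>The lift ends in the copower; \<open>\<pi>\<close> brings it back to X.\<close>
  define t where "t = compose (carrier X) \<pi> h"
  have "t \<in> rmod_hom A X X"
    unfolding t_def by (rule X.rmod_hom_compose[OF \<pi> h])
  moreover have "s (t (s x)) = s x" if x: "x \<in> carrier X" for x
  proof -
    \<comment> \<open>This puts \<open>\<iota> (s x)\<close> into the image of
      \<open>\<phi>\<close>, where \<open>p\<close> is the identity, so \<open>h_lift\<close> at s x
      loses its \<open>p\<close>.\<close>
    have "\<iota> (s x) = \<phi> (\<iota> x)"
      using x \<iota>D(2) by (simp add: \<phi>_eq \<pi>\<iota>)
    then have "\<phi> (h (s x)) = \<iota> (s x)"
      using x sD(2) \<iota>D(2) by (simp add: h_lift compose_eq p_id)
    \<comment> \<open>Unfolding \<open>\<phi>\<close> turns \<open>\<pi> (h (s x))\<close> into t (s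
      x); applying \<open>\<pi>\<close> to both sides then allows \<open>\<iota>\<close> to be
      cancelled.\<close>
    then have "\<pi> (\<iota> (s (t (s x)))) = \<pi> (\<iota> (s x))"
      using x sD(2) rmod_homD(2)[OF h] by (simp add: \<phi>_eq t_def compose_eq)
    then show ?thesis
      using x sD(2) \<pi>D(2) rmod_homD(2)[OF h] by (simp add: \<pi>\<iota> t_def compose_eq)
  qed
  ultimately show ?thesis by blast
qed

theorem proposition5p5:
  fixes A :: "('a, 'r) ring_scheme" and X :: "('a, 'x, 'm) rmodule_scheme"
  assumes "ring A"
    and "right_module A X"
    and "projective A X"
    and "sigma_d_rickart A X"
  shows "von_neumann_regular (End_ring A X)"
  unfolding von_neumann_regular_def
proof (intro conjI ballI)
  interpret X: right_module A X by fact
  show "ring (End_ring A X)" by (rule X.ring_End_ring)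
  fix s assume "s \<in> carrier (End_ring A X)"
  then have s: "s \<in> rmod_hom A X X" by (simp add: End_ring_def)
  \<comment> \<open>A singleton is a non-empty index set; \<open>Inr 0\<close> is a concrete point
    of the index type fixed in \<open>sigma_d_rickart\<close>.\<close>
  have "d_rickart A (copower X {Inr 0 :: 'x + nat})"
    using assms(4) by (simp add: sigma_d_rickart_def)
  then have "\<exists>t\<in>rmod_hom A X X. \<forall>x\<in>carrier X. s (t (s x)) = s x"
    by (rule rmod_hom_regular[OF assms(2,3) _ s])
  then obtain t where t: "t \<in> rmod_hom A X X" and sts: "\<forall>x\<in>carrier X. s (t (s x)) = s x"
    by (elim bexE)
  \<comment> \<open>Both sides are extensional, so the identity on \<open>carrier X\<close> becomes
    an equality of ring elements, bracketed like the product in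
    \<open>von_neumann_regular\<close>.\<close>
  have "compose (carrier X) (compose (carrier X) s t) s = s"
  proof (rule rmod_hom_eqI)
    show "compose (carrier X) (compose (carrier X) s t) s \<in> rmod_hom A X X"
      by (intro X.rmod_hom_compose[of _ X] s t)
    show "compose (carrier X) (compose (carrier X) s t) s x = s x" if "x \<in> carrier X" for x
      using bspec[OF sts that] that rmod_homD(2)[OF s] by (simp add: compose_eq)
  qed (rule s)
  then have "s \<otimes>\<^bsub>End_ring A X\<^esub> t \<otimes>\<^bsub>End_ring A X\<^esub> s = s"
    by (simp add: End_ring_def)
  then show "\<exists>t\<in>carrier (End_ring A X). s \<otimes>\<^bsub>End_ring A X\<^esub> t \<otimes>\<^bsub>End_ring A X\<^esub> s = s"
    using t by (intro bexI[of _ t]) (simp_all add: End_ring_def)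
qed

end
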